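(* $FMC(6)=\{ (m,6) : 3\leq m\leq 6 \} \cup \{ (3,7) \} \cup \{ (m,8) : 3\leq m\leq 8 \}$, where $m$ ranges over integers.
   Context: A (proper) $n$-edge-coloring of a graph $G$ is a mapping from $E(G)$ into a set of $n$ colors such that any two edges sharing a vertex receive distinct colors. A subgraph of an edge-colored graph is multicolored if no two of its edges have the same color. An edge-coloring of $G$ forbids multicolored $H$'s if each copy of $H$ in $G$ has two edges with the same color. For an integer $k\geq 2$, $FMC(2k)$ (the forbidding multicolored $2k$-cycles set) is the set of ordered pairs of integers $(m,n)$ with $k\leq m\leq n$ and $n\geq 2k$ such that there exists a (proper) $n$-edge-coloring of the complete bipartite graph $K_{m,n}$ that forbids multicolored $2k$-cycles. In particular, $FMC(6)$ consists of the pairs $(m,n)$ with $3\leq m\leq n$, $n\geq 6$, such that $K_{m,n}$ has an $n$-edge-coloring with no multicolored $6$-cycle. *)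

theory Defs
  imports Main
begin

text \<open>A graph is a pair of a vertex set and a set of edges, each edge being a two-element
  set of vertices.\<close>

type_synonym 'a graph = "'a set \<times> 'a set set"

abbreviation verts :: "'a graph \<Rightarrow> 'a set" where
  "verts G \<equiv> fst G"

abbreviation edges :: "'a graph \<Rightarrow> 'a set set" where
  "edges G \<equiv> snd G"

definition simple_graph :: "'a graph \<Rightarrow> bool" where
  "simple_graph G \<longleftrightarrow> (\<forall>e\<in>edges G. e \<subseteq> verts G \<and> card e = 2)"

definition subgraph :: "'a graph \<Rightarrow> 'a graph \<Rightarrow> bool" where
  "subgraph H G \<longleftrightarrow> simple_graph H \<and> verts H \<subseteq> verts G \<and> edges H \<subseteq> edges G"

definition graph_iso :: "'a graph \<Rightarrow> 'b graph \<Rightarrow> bool" where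
  "graph_iso G H \<longleftrightarrow>
    (\<exists>f. bij_betw f (verts G) (verts H) \<and> edges H = (\<lambda>e. f ` e) ` edges G)"

definition complete_bipartite :: "nat \<Rightarrow> nat \<Rightarrow> (nat + nat) graph" where
  "complete_bipartite m n =
    (Inl ` {..<m} \<union> Inr ` {..<n}, {{Inl i, Inr j} |i j. i < m \<and> j < n})"

text \<open>This is a cycle only for \<open>l \<ge> 3\<close>.\<close>

definition cycle_graph :: "nat \<Rightarrow> nat graph" where
  "cycle_graph l = ({..<l}, {{i, Suc i mod l} |i. i < l})"

definition proper_edge_coloring :: "'a graph \<Rightarrow> 'c set \<Rightarrow> ('a set \<Rightarrow> 'c) \<Rightarrow> bool" where
  "proper_edge_coloring G C c \<longleftrightarrow>
    (\<forall>e\<in>edges G. c e \<in> C) \<and>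
    (\<forall>e\<in>edges G. \<forall>e'\<in>edges G. e \<noteq> e' \<and> e \<inter> e' \<noteq> {} \<longrightarrow> c e \<noteq> c e')"

definition multicolored :: "('a set \<Rightarrow> 'c) \<Rightarrow> 'a graph \<Rightarrow> bool" where
  "multicolored c H \<longleftrightarrow> inj_on c (edges H)"

definition forbids_multicolored :: "'a graph \<Rightarrow> ('a set \<Rightarrow> 'c) \<Rightarrow> 'b graph \<Rightarrow> bool" where
  "forbids_multicolored G c H \<longleftrightarrow>
    (\<forall>H'. subgraph H' G \<and> graph_iso H H' \<longrightarrow> \<not> multicolored c H')"

text \<open>The argument is the cycle length \<open>l = 2 * k\<close>; for \<open>l\<close> odd or less than \<open>4\<close> the set
  is empty. The set of \<open>n\<close> colors is taken to be \<open>{..<n}\<close>; not all colors need be used.\<close>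

definition FMC :: "nat \<Rightarrow> (nat \<times> nat) set" where
  "FMC l = {(m, n). \<exists>k\<ge>2. l = 2 * k \<and> k \<le> m \<and> m \<le> n \<and> 2 * k \<le> n \<and>
    (\<exists>c. proper_edge_coloring (complete_bipartite m n) {..<n} c \<and>
         forbids_multicolored (complete_bipartite m n) c (cycle_graph (2 * k)))}"

end

theory Submission imports Defs begin

text \<open>A proper coloring of \<open>K\<^sub>m\<^sub>,\<^sub>n\<close> with \<open>n\<close> colors, \<open>m \<le> n\<close>, is an \<open>m \<times> n\<close> Latin rectangle \<open>A\<close>: the entry
  in row \<open>i\<close> and column \<open>j\<close> is the color of the edge \<open>ij\<close>, and every row is a permutation of the
  colors. A 6-cycle consists of three rows and three columns, where each column
  contributes its entries in two of the rows and each of the three columns omits a different row. The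
  question is which rectangles have no such hexagon with six distinct entries.

  Three rows admit at most 8 columns by a greedy choice (\<open>at_most_eight_columns\<close>): fix the first
  column of the hexagon; the second one has to avoid 4 coincidences and the third one 8, each of
  which is met by at most one column.

  For 7 columns the greedy choice fails only barely, so that every coincidence it counts has to take
  place. Three rows without a rainbow hexagon turn out to contain a \<open>3 \<times> 3\<close> cyclic Latin square
  in three of the columns (\<open>exists_cyclic_block\<close>). Let \<open>\<sigma>\<close> be the fixed-point-free permutation that takes
  the first row to the second. The block is a 3-cycle of \<open>\<sigma>\<close>, and there the third row is determined
  by the first two. With a fourth row there would be two such blocks for the same \<open>\<sigma>\<close>. They are disjoint,
  as the third and the fourth row differ in every column, and then \<open>\<sigma>\<close> fixes the one color left over:
  contradiction (\<open>no_four_rows_of_length_7\<close>).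

  Constructions: for 6 columns the addition table of the cyclic group of order 6, and for 8 columns
  that of the elementary abelian group of order 8. In both, the six entries of a hexagon satisfy a
  parity condition, since every row and column index enters it twice, and six distinct entries would
  violate it. Fewer rows are obtained by restriction. For \<open>(3, 7)\<close>, three rows of the addition table
  of the Klein four-group are placed beside a cyclic Latin square of order 3.\<close>

section \<open>Counting tools\<close>

lemma even_card_fixpoint_free_involution:
  assumes "finite X" and "\<And>x. x \<in> X \<Longrightarrow> p x \<in> X"
    and "\<And>x. x \<in> X \<Longrightarrow> p (p x) = x" and "\<And>x. x \<in> X \<Longrightarrow> p x \<noteq> x"
  shows "even (card X)"
proof -
  let ?O = "(\<lambda>x. {x, p x}) ` X"
  have un: "\<Union>?O = X" using assms(2) by auto
  have "2 * card ?O = card (\<Union>?O)"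
  proof (rule card_partition)
    show "finite ?O" "finite (\<Union>?O)" using assms(1) un by auto
    show "card c = 2" if "c \<in> ?O" for c
      using that assms(4) by (fastforce simp: card_2_iff)
    show "c1 \<inter> c2 = {}" if c: "c1 \<in> ?O" "c2 \<in> ?O" "c1 \<noteq> c2" for c1 c2
    proof -
      obtain a b where ab: "a \<in> X" "b \<in> X" "c1 = {a, p a}" "c2 = {b, p b}"
        using c by blast
      have "p (p a) = a" "p (p b) = b" using ab assms(3) by simp_all
      moreover have "{a, p a} \<noteq> {b, p b}" using c(3) ab by simp
      ultimately have "a \<noteq> b" "a \<noteq> p b" "p a \<noteq> b" "p a \<noteq> p b"
        by (metis insert_commute)+
      then show ?thesis using ab by simp
    qed
  qed
  then show ?thesis unfolding un by (metis dvd_triv_left)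
qed

lemma card_inj_fibre_le_one:
  assumes "inj_on F X" shows "card {z \<in> X. F z = t} \<le> 1"
proof (cases "\<exists>x\<in>X. F x = t")
  case True
  then obtain x where "x \<in> X" "F x = t" by blast
  then have "{z \<in> X. F z = t} \<subseteq> {x}" using assms by (auto dest: inj_onD)
  then show ?thesis using card_mono[of "{x}"] by simp
next
  case False
  then have "{z \<in> X. F z = t} = {}" by blast
  then show ?thesis by (metis card.empty zero_le)
qed

text \<open>Each condition \<open>F z \<noteq> t\<close> with \<open>F\<close> injective excludes at most one \<open>z\<close>. This is the counting step of
  every greedy choice below.\<close>

lemma avoid_values:
  assumes "finite X" and "length ps < card X" and "\<forall>(F, t) \<in> set ps. inj_on F X"
  shows "\<exists>z\<in>X. \<forall>(F, t) \<in> set ps. F z \<noteq> t"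
proof -
  have "card (\<Union>(F, t) \<in> set ps. {z \<in> X. F z = t}) \<le> length ps"
    using assms(3)
  proof (induction ps)
    case (Cons q ps)
    obtain F t where q: "q = (F, t)" by force
    have "card ({z \<in> X. F z = t} \<union> (\<Union>(F, t) \<in> set ps. {z \<in> X. F z = t})) \<le> 1 + length ps"
      using Cons card_inj_fibre_le_one[of F X t] q
      by (intro order_trans[OF card_Un_le] add_mono) auto
    then show ?case by (simp add: q)
  qed simp
  moreover have "(\<Union>(F, t) \<in> set ps. {z \<in> X. F z = t}) \<subseteq> X" by auto
  ultimately have "(\<Union>(F, t) \<in> set ps. {z \<in> X. F z = t}) \<subset> X"
    using assms(2) by auto
  then show ?thesis by fastforce
qed

text \<open>The extremal case of the greedy choice: three conditions that together exclude all of a three-element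
  set must exclude one element each.\<close>

lemma three_values_hit:
  fixes F G H :: "'a \<Rightarrow> 'b"
  assumes "finite U" "card U = 3" and "inj_on F U" "inj_on G U" "inj_on H U"
    and cov: "\<And>z. z \<in> U \<Longrightarrow> r = F z \<or> s = G z \<or> t = H z"
  shows "r \<in> F ` U \<and> s \<in> G ` U \<and> t \<in> H ` U"
proof (intro conjI; rule ccontr)
  assume "r \<notin> F ` U"
  then show False using avoid_values[of U "[(G, s), (H, t)]"] assms by fastforce
next
  assume "s \<notin> G ` U"
  then show False using avoid_values[of U "[(F, r), (H, t)]"] assms by fastforce
next
  assume "t \<notin> H ` U"
  then show False using avoid_values[of U "[(F, r), (G, s)]"] assms by fastforce
qed

section \<open>Three rows without a rainbow hexagon\<close>

text \<open>Three rows \<open>f\<close>, \<open>g\<close>, \<open>h\<close> over the column set \<open>X\<close>. In a hexagon, \<open>x\<close> omits row \<open>h\<close>, \<open>y\<close> omits row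
  \<open>f\<close> and \<open>z\<close> omits row \<open>g\<close>; as \<open>x\<close>, \<open>y\<close>, \<open>z\<close> are arbitrary, this one pattern covers all
  assignments of omitted rows to three columns. Six distinct entries force the three columns to be
  distinct.\<close>

locale hexagon_free_rows =
  fixes X :: "'a set" and f g h :: "'a \<Rightarrow> 'b"
  assumes inj: "inj_on f X" "inj_on g X" "inj_on h X"
    and column_distinct: "x \<in> X \<Longrightarrow> f x \<noteq> g x" "x \<in> X \<Longrightarrow> g x \<noteq> h x" "x \<in> X \<Longrightarrow> h x \<noteq> f x"
    and hexagon_free: "\<lbrakk>x \<in> X; y \<in> X; z \<in> X\<rbrakk> \<Longrightarrow> \<not> distinct [f x, g x, g y, h y, h z, f z]"
begin

lemma column_eqI:
  "\<lbrakk>x \<in> X; y \<in> X; f x = f y\<rbrakk> \<Longrightarrow> x = y" "\<lbrakk>x \<in> X; y \<in> X; g x = g y\<rbrakk> \<Longrightarrow> x = y"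
  "\<lbrakk>x \<in> X; y \<in> X; h x = h y\<rbrakk> \<Longrightarrow> x = y"
  using inj by (auto dest: inj_onD)

text \<open>Once \<open>y\<close> and \<open>z\<close> avoid the two colors taken from \<open>x\<close>, only three coincidences between \<open>y\<close> and \<open>z\<close>
  can spoil the hexagon.\<close>

lemma clash:
  assumes "x \<in> X" "y \<in> X" "z \<in> X" "y \<noteq> z"
    and "g y \<noteq> f x" "g y \<noteq> g x" "h y \<noteq> f x" "h y \<noteq> g x"
    and "h z \<noteq> f x" "h z \<noteq> g x" "f z \<noteq> f x" "f z \<noteq> g x"
  shows "g y = h z \<or> g y = f z \<or> h y = f z"
  using hexagon_free[of x y z] column_distinct[of x] column_distinct[of y] column_distinct[of z]
    column_eqI(3)[of y z] assms by auto

text \<open>Exchanging the first two rows reverses the direction in which the hexagon is traversed.\<close>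

lemma swap_rows: "hexagon_free_rows X g f h"
proof
  show "\<not> distinct [g x, f x, f y, h y, h z, g z]" if "x \<in> X" "y \<in> X" "z \<in> X" for x y z
    using hexagon_free[of x z y] that by auto
qed (use inj column_distinct in \<open>metis+\<close>)

lemma at_most_eight_columns:
  assumes "finite X" shows "card X \<le> 8"
proof (rule ccontr)
  assume "\<not> card X \<le> 8"
  then have big: "card X > 8" by simp
  then obtain x where x: "x \<in> X" by fastforce
  \<comment> \<open>The column \<open>x\<close> itself is excluded by \<open>g y \<noteq> g x\<close>, so 4 columns are lost in total.\<close>
  obtain y where y: "y \<in> X" "g y \<noteq> f x" "g y \<noteq> g x" "h y \<noteq> f x" "h y \<noteq> g x"
    using avoid_values[of X "[(g, f x), (g, g x), (h, f x), (h, g x)]"] assms big inj by auto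
  \<comment> \<open>Likewise \<open>f z \<noteq> f x\<close> excludes \<open>x\<close> and \<open>h z \<noteq> h y\<close> excludes \<open>y\<close>: 8 columns in total.\<close>
  obtain z where z: "z \<in> X" "f z \<noteq> f x" "f z \<noteq> g x" "h z \<noteq> f x" "h z \<noteq> g x"
      "h z \<noteq> h y" "h z \<noteq> g y" "f z \<noteq> h y" "f z \<noteq> g y"
    using avoid_values[of X "[(f, f x), (f, g x), (h, f x), (h, g x), (h, h y), (h, g y), (f, h y), (f, g y)]"]
      assms big inj by auto
  show False using clash[of x y z] x y z by auto
qed

end

section \<open>Three rows of length seven contain a cyclic block\<close>

text \<open>In this section \<open>x\<close> is a column with \<open>a = f x\<close> and \<open>b = g x\<close>. The other places of these two
  colors are column \<open>p\<close> with \<open>b\<close> in row \<open>f\<close>, column \<open>q\<close> with \<open>a\<close> in row \<open>g\<close>, column \<open>r\<close> with \<open>a\<close> in row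
  \<open>h\<close> and column \<open>s\<close> with \<open>b\<close> in row \<open>h\<close>. The proof distinguishes which of these four columns
  coincide. Exchanging the rows \<open>f\<close> and \<open>g\<close> exchanges \<open>p\<close> with \<open>q\<close> and \<open>r\<close> with \<open>s\<close>.\<close>

locale hexagon_free_rows_7 = hexagon_free_rows +
  fixes C :: "'b set"
  assumes onto: "f ` X = C" "g ` X = C" "h ` X = C"
    and card_7: "card X = 7"
begin

lemma finite_X: "finite X"
  using card_7 card.infinite by fastforce

lemma swap_rows_7: "hexagon_free_rows_7 X g f h C"
  using swap_rows onto card_7 by (simp add: hexagon_free_rows_7_def hexagon_free_rows_7_axioms_def)

text \<open>The columns \<open>(a, b, c)\<close>, \<open>(b, c, a)\<close>, \<open>(c, a, b)\<close>.\<close>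

definition cyclic_block :: "'a \<Rightarrow> 'a \<Rightarrow> 'a \<Rightarrow> bool" where
  "cyclic_block x y z \<longleftrightarrow> x \<in> X \<and> y \<in> X \<and> z \<in> X \<and>
     f y = g x \<and> g y = h x \<and> h y = f x \<and> f z = h x \<and> g z = f x \<and> h z = g x"

text \<open>The case \<open>p = r\<close> and \<open>q = s\<close>. The four columns of \<open>?T\<close> avoid \<open>a\<close> and \<open>b\<close>. For \<open>y\<close> in \<open>?T\<close> each of
  the three remaining columns must show one of the three coincidences of \<open>clash\<close>, so
  all three coincidences occur. Hence the colors of row \<open>g\<close> on \<open>?T\<close> also occur there in rows \<open>f\<close>
  and \<open>h\<close>. So \<open>h x\<close> and \<open>f q\<close>, which rows \<open>h\<close> and \<open>f\<close> place outside \<open>?T\<close>, are outside \<open>?T\<close> in row \<open>g\<close>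
  as well, and the only position left for either is column \<open>p\<close>.\<close>

lemma cyclic_block_if_pair_in_three_columns:
  assumes "x \<in> X" "p \<in> X" "q \<in> X"
    and p: "f p = g x" "h p = f x" and q: "g q = f x" "h q = g x"
  shows "cyclic_block x p q"
proof -
  let ?T = "X - {x, p, q}"
  have "x \<noteq> p" "x \<noteq> q" "p \<noteq> q" using assms column_distinct by metis+
  then have card_T: "card ?T = 4" using assms card_7 by simp
  have hit: "g y \<in> h ` ?T \<and> g y \<in> f ` ?T \<and> h y \<in> f ` ?T" if y: "y \<in> ?T" for y
  proof -
    have "g y \<in> h ` (?T - {y}) \<and> g y \<in> f ` (?T - {y}) \<and> h y \<in> f ` (?T - {y})"
    proof (rule three_values_hit)
      show "card (?T - {y}) = 3" using card_T y by simp
      show "g y = h z \<or> g y = f z \<or> h y = f z" if "z \<in> ?T - {y}" for z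
        using that y assms by (intro clash[of x]) (metis DiffE insertCI column_eqI)+
    qed (use finite_X inj in \<open>auto intro: inj_on_subset\<close>)
    then show ?thesis by blast
  qed
  have "h x \<notin> h ` ?T" "f q \<notin> f ` ?T" using column_eqI assms(1-3) by blast+
  then have "h x \<notin> g ` ?T" "f q \<notin> g ` ?T" using hit by (metis imageE)+
  moreover have "h x \<in> g ` X" "f q \<in> g ` X" using onto assms(1-3) by (metis imageI)+
  ultimately have "h x \<in> g ` {x, p, q}" "f q \<in> g ` {x, p, q}" by blast+
  moreover have "h x \<noteq> g x" "h x \<noteq> g q" "f q \<noteq> g q" "f q \<noteq> g x"
    using assms column_distinct \<open>p \<noteq> q\<close> column_eqI(1)[of p q] by metis+
  ultimately have "h x = g p" "f q = g p" by auto
  then show ?thesis using assms by (simp add: cyclic_block_def)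
qed

text \<open>The case \<open>p = r\<close> and \<open>q \<noteq> s\<close>. The argument is the same as for three columns, but \<open>y\<close> ranges over the
  three columns of \<open>?U\<close> and \<open>z\<close> over \<open>?Z\<close>, which also contains \<open>q\<close>. Tracing the color \<open>f s\<close> shows that it
  equals \<open>g p\<close> and is \<open>h x\<close> or \<open>h q\<close>. In the first case \<open>p\<close>, \<open>s\<close>, \<open>x\<close> satisfy the hypotheses of
  \<open>cyclic_block_if_pair_in_three_columns\<close>; the second case is impossible.\<close>

lemma cyclic_block_if_pair_in_two_columns:
  assumes X: "x \<in> X" "p \<in> X" "q \<in> X" "s \<in> X"
    and p: "f p = g x" "h p = f x" and q: "g q = f x" and s: "h s = g x" and "q \<noteq> s"
  shows "\<exists>x y z. cyclic_block x y z"
proof -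
  let ?U = "X - {x, p, q, s}"
  let ?Z = "insert q ?U"
  have ne: "x \<noteq> p" "x \<noteq> q" "p \<noteq> q" "x \<noteq> s" "p \<noteq> s" using assms column_distinct by metis+
  then have card_U: "card ?U = 3" using X card_7 \<open>q \<noteq> s\<close> by simp
  have clash_U: "g y = h z \<or> g y = f z \<or> h y = f z" if "y \<in> ?U" "z \<in> ?Z - {y}" for y z
    using that assms ne by (intro clash[of x]) (metis DiffE insertCI insertE column_eqI)+
  have hit: "g y \<in> h ` ?Z \<and> g y \<in> f ` ?Z \<and> h y \<in> f ` ?Z" if y: "y \<in> ?U" for y
  proof -
    have "g y \<in> h ` (?Z - {y}) \<and> g y \<in> f ` (?Z - {y}) \<and> h y \<in> f ` (?Z - {y})"
    proof (rule three_values_hit)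
      show "card (?Z - {y}) = 3" using card_U y finite_X by (simp add: card_insert_if)
    qed (use finite_X inj X clash_U[OF y] in \<open>auto intro: inj_on_subset\<close>)
    then show ?thesis by blast
  qed
  have "f s \<notin> f ` ?Z" using column_eqI(1) X \<open>q \<noteq> s\<close> by blast
  then have fs: "f s \<notin> g ` ?U" "f s \<notin> h ` ?U" using hit by (metis imageE)+
  have "f s \<in> g ` X" "f s \<in> h ` X" using onto X by (metis imageI)+
  then have "f s \<in> g ` {x, p, q, s}" "f s \<in> h ` {x, p, q, s}" using fs by blast+
  moreover have "f s \<noteq> g x" "f s \<noteq> f x" "f s \<noteq> g s" "f s \<noteq> h s"
    using assms ne column_eqI column_distinct by metis+
  ultimately have gp: "f s = g p" and hx: "f s = h x \<or> f s = h q" using assms by auto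
  have "f s \<noteq> h q"
  proof
    assume fshq: "f s = h q"
    \<comment> \<open>The color \<open>f q\<close> alone would have to spoil all hexagons through \<open>x\<close>, \<open>y\<close>, \<open>q\<close> with \<open>y\<close> in
      \<open>?U\<close>, but it occurs once per row.\<close>
    have "g y = f q \<or> h y = f q" if "y \<in> ?U" for y
      using clash_U[of y q] that gp fshq column_eqI(2)[of y p] X by auto
    then show False
      using avoid_values[of ?U "[(g, f q), (h, f q)]"] card_U finite_X inj
      by (fastforce intro: inj_on_subset)
  qed
  then have "cyclic_block p s x"
    using assms gp hx by (intro cyclic_block_if_pair_in_three_columns) auto
  then show ?thesis by blast
qed

lemma cyclic_block_swap_rows:
  assumes "hexagon_free_rows_7.cyclic_block X g f h x y z"
  shows "cyclic_block x z y"
  using assms swap_rows_7 by (auto simp: hexagon_free_rows_7.cyclic_block_def cyclic_block_def)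

text \<open>The case in which \<open>a\<close> and \<open>b\<close> are spread over five distinct columns is contradictory. The hexagon
  through \<open>x\<close>, \<open>p\<close>, \<open>q\<close> leaves three possibilities: \<open>g p = f q\<close>, \<open>g p = h q\<close> or \<open>h p = f q\<close>, and the
  last two are exchanged by exchanging the rows \<open>f\<close> and \<open>g\<close>. The remaining two columns \<open>u\<close> and \<open>v\<close>
  contain neither \<open>a\<close> nor \<open>b\<close>.

  If \<open>g p = f q\<close>, the hexagons through \<open>x\<close>, \<open>p\<close> and \<open>u\<close> or \<open>v\<close> force \<open>f u = h p\<close> and \<open>h v = g p\<close> up to the
  order of \<open>u\<close> and \<open>v\<close>. Then the one through \<open>x\<close>, \<open>u\<close>, \<open>q\<close> forces \<open>g u = h q\<close>, and the one through \<open>p\<close>,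
  \<open>q\<close>, \<open>u\<close> is rainbow.\<close>

lemma five_columns_exclude_3cycle:
  assumes X: "x \<in> X" "p \<in> X" "q \<in> X" "r \<in> X" "s \<in> X" "u \<in> X" "v \<in> X"
    and d: "distinct [x, p, q, r, s, u, v]"
    and eqs: "f p = g x" "g q = f x" "h r = f x" "h s = g x"
    and c: "g p = f q"
  shows False
proof -
  have main: False if u: "u \<in> X" "v \<in> X" "distinct [x, p, q, r, s, u, v]" "f u = h p" "h v = g p" for u v
  proof -
    have "g u = h q"
      using clash[of x u q] that X eqs c column_eqI by (auto, metis+)
    then show False
      using clash[of p q u] that X eqs c column_eqI column_distinct by (auto, metis+)
  qed
  have "f w = h p \<or> h w = g p" if "w \<in> {u, v}" for w
    using clash[of x p w] that X eqs c d column_eqI by (auto, metis+)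
  then have "f u = h p \<and> h v = g p \<or> f v = h p \<and> h u = g p"
    using column_eqI X d by (metis distinct_length_2_or_more insertCI)
  then show False using main[of u v] main[of v u] X d by auto
qed

text \<open>Here the hexagons through \<open>x\<close>, \<open>p\<close> and \<open>u\<close> or \<open>v\<close> force \<open>f u = g p\<close> and \<open>f v = h p\<close> up to the order
  of \<open>u\<close> and \<open>v\<close>. The hexagon through \<open>p\<close>, \<open>u\<close>, \<open>x\<close> then requires \<open>g u = h x\<close>, and this contradicts the
  one through \<open>x\<close>, \<open>u\<close>, \<open>v\<close>.\<close>

lemma five_columns_exclude_shared_value:
  assumes X: "x \<in> X" "p \<in> X" "q \<in> X" "r \<in> X" "s \<in> X" "u \<in> X" "v \<in> X"
    and d: "distinct [x, p, q, r, s, u, v]"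
    and eqs: "f p = g x" "g q = f x" "h r = f x" "h s = g x"
    and c: "h q = g p"
  shows False
proof -
  have main: False if u: "u \<in> X" "v \<in> X" "distinct [x, p, q, r, s, u, v]" "f u = g p" "f v = h p" for u v
  proof -
    have ne: "x \<noteq> u" "s \<noteq> u" "r \<noteq> u" "q \<noteq> u" "p \<noteq> u" "q \<noteq> x" "q \<noteq> p"
      using that(3) by auto
    have "g u = h x"
    proof (rule ccontr)
      assume "g u \<noteq> h x"
      moreover have "f p \<noteq> g u" "f p \<noteq> h u" "g p \<noteq> g u" "g p \<noteq> h u" "g p \<noteq> h x" "g p \<noteq> f x"
          "g u \<noteq> f x" "h u \<noteq> h x" "h u \<noteq> f x"
        using eqs c ne X that(1) by (metis column_eqI)+
      ultimately show False
        using hexagon_free[of p u x] column_distinct[of p] column_distinct[of u] column_distinct[of x]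
          X eqs that(1) by auto
    qed
    moreover have "g u = h v \<or> g u = f v \<or> h u = f v"
      using clash[of x u v] that X eqs column_eqI by (auto, metis+)
    ultimately show False
      using X that ne column_eqI(3)[of x v] column_eqI(3)[of x p] column_eqI(3)[of u p] by auto
  qed
  have "f w = g p \<or> f w = h p" if "w \<in> {u, v}" for w
    using clash[of x p w] that X eqs c d column_eqI by (auto, metis+)
  then have "f u = g p \<and> f v = h p \<or> f v = g p \<and> f u = h p"
    using column_eqI X d by (metis distinct_length_2_or_more insertCI)
  then show False using main[of u v] main[of v u] X d by auto
qed

text \<open>Seven is odd: if \<open>p = q\<close> for every column \<open>x\<close>, then \<open>x \<mapsto> p\<close> would be a fixed-point-free involution.\<close>

lemma exists_column_not_transposed:
  "\<exists>x\<in>X. \<exists>p\<in>X. \<exists>q\<in>X. f p = g x \<and> g q = f x \<and> p \<noteq> q"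
proof (rule ccontr)
  assume *: "\<not> ?thesis"
  define next_col where "next_col x = inv_into X f (g x)" for x
  have nxt: "next_col x \<in> X" "f (next_col x) = g x" if "x \<in> X" for x
    using that onto unfolding next_col_def
    by (metis imageI inv_into_into) (metis that onto imageI f_inv_into_f)
  have prev: "g (next_col x) = f x" if "x \<in> X" for x
  proof -
    have "f x \<in> g ` X" using that onto by (metis imageI)
    then obtain q where "q \<in> X" "g q = f x" by (metis imageE)
    moreover have "next_col x = q" using * nxt[OF that] that calculation by blast
    ultimately show ?thesis by simp
  qed
  have "even (card X)"
  proof (rule even_card_fixpoint_free_involution)
    show "next_col (next_col x) = x" if "x \<in> X" for x
      using that nxt prev column_eqI(1) by metis
    show "next_col x \<noteq> x" if "x \<in> X" for x
      using that nxt(2) column_distinct(1) by metis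
  qed (use finite_X nxt in auto)
  then show False using card_7 by simp
qed

lemma exists_cyclic_block: "\<exists>x y z. cyclic_block x y z"
proof -
  obtain x p q where X: "x \<in> X" "p \<in> X" "q \<in> X" and pq: "f p = g x" "g q = f x" "p \<noteq> q"
    using exists_column_not_transposed by blast
  obtain r s where rs: "r \<in> X" "h r = f x" "s \<in> X" "h s = g x"
    using X(1) onto by (metis imageE imageI)
  consider "p = r" "q = s" | "p = r" "q \<noteq> s" | "p \<noteq> r" "q = s" | "p \<noteq> r" "q \<noteq> s" by blast
  then show ?thesis
  proof cases
    case 1
    then show ?thesis using cyclic_block_if_pair_in_three_columns X pq rs by blast
  next
    case 2
    then show ?thesis using cyclic_block_if_pair_in_two_columns[of x p q s] X pq rs by blast
  next
    case 3
    interpret swapped: hexagon_free_rows_7 X g f h C by (rule swap_rows_7)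
    show ?thesis
      using swapped.cyclic_block_if_pair_in_two_columns[of x q p r] cyclic_block_swap_rows 3 X pq rs
      by blast
  next
    case 4
    interpret swapped: hexagon_free_rows_7 X g f h C by (rule swap_rows_7)
    have d5: "distinct [x, p, q, r, s]"
      using 4 X pq rs column_distinct by (auto, metis+)
    then have "card (X - {x, p, q, r, s}) = 2"
      using X rs finite_X card_7 by (subst card_Diff_subset) auto
    then obtain u v where "X - {x, p, q, r, s} = {u, v}" "u \<noteq> v" by (auto simp: card_2_iff)
    then have uv: "u \<in> X" "v \<in> X" "distinct [x, p, q, r, s, u, v]" "distinct [x, q, p, s, r, u, v]"
      using d5 by auto
    have "g p = h q \<or> g p = f q \<or> h p = f q"
      using clash[of x p q] 4 X pq rs column_eqI column_distinct by metis
    then show ?thesis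
      using five_columns_exclude_3cycle[of x p q r s u v] five_columns_exclude_shared_value[of x p q r s u v]
        swapped.five_columns_exclude_shared_value[of x q p s r u v] X pq rs uv by metis
  qed
qed

text \<open>What two blocks for the same rows \<open>f\<close> and \<open>g\<close> are compared by: \<open>B\<close> is invariant under the permutation that
  takes row \<open>f\<close> to row \<open>g\<close>, and on \<open>B\<close> row \<open>h\<close> is the image of row \<open>g\<close> under that permutation.\<close>

lemma exists_closed_column_set:
  "\<exists>B\<subseteq>X. card B = 3 \<and> g ` B = f ` B \<and> (\<forall>m\<in>B. \<exists>m'\<in>X. f m' = g m \<and> g m' = h m)"
proof -
  obtain x y z where xyz: "cyclic_block x y z" using exists_cyclic_block by blast
  then have X: "x \<in> X" "y \<in> X" "z \<in> X"
    and b: "f y = g x" "g y = h x" "h y = f x" "f z = h x" "g z = f x" "h z = g x"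
    by (simp_all only: cyclic_block_def)
  have "x \<noteq> y" "x \<noteq> z" "y \<noteq> z"
    using column_distinct[OF X(1)] b(1,3-6) by metis+
  then have "card {x, y, z} = 3" by simp
  moreover have "g ` {x, y, z} = f ` {x, y, z}" using b by auto
  moreover have "\<exists>m'\<in>X. f m' = g m \<and> g m' = h m" if "m \<in> {x, y, z}" for m
    using that X b by (metis insertE singletonD)
  ultimately show ?thesis using X by (intro exI[of _ "{x, y, z}"]) blast
qed

end

section \<open>Four rows of length seven\<close>

lemma no_four_rows_of_length_7:
  assumes h: "hexagon_free_rows_7 X f g h C" and k: "hexagon_free_rows_7 X f g k C"
    and hk: "\<And>x. x \<in> X \<Longrightarrow> h x \<noteq> k x"
  shows False
proof -
  interpret h: hexagon_free_rows_7 X f g h C by (rule h)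
  interpret k: hexagon_free_rows_7 X f g k C by (rule k)
  obtain B where B: "B \<subseteq> X" "card B = 3" "g ` B = f ` B"
    "\<forall>m\<in>B. \<exists>m'\<in>X. f m' = g m \<and> g m' = h m" using h.exists_closed_column_set by (elim exE conjE) (rule that)
  obtain D where D: "D \<subseteq> X" "card D = 3" "g ` D = f ` D"
    "\<forall>m\<in>D. \<exists>m'\<in>X. f m' = g m \<and> g m' = k m" using k.exists_closed_column_set by (elim exE conjE) (rule that)
  have "m \<notin> D" if "m \<in> B" for m
  proof
    assume "m \<in> D"
    then obtain m1 m2 where "m1 \<in> X" "f m1 = g m" "g m1 = h m" "m2 \<in> X" "f m2 = g m" "g m2 = k m"
      using B(4) D(4) \<open>m \<in> B\<close> by blast
    then have "h m = k m" using h.column_eqI(1)[of m1 m2] by simp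
    then show False using hk B(1) \<open>m \<in> B\<close> by blast
  qed
  then have "B \<inter> D = {}" by blast
  then have "card (B \<union> D) = 6"
    using B D h.finite_X by (simp add: card_Un_disjoint finite_subset)
  then have "card (X - (B \<union> D)) = 1"
    using B D h.finite_X h.card_7 by (subst card_Diff_subset) (auto intro: finite_subset)
  then obtain w where w: "X - (B \<union> D) = {w}" by (auto simp: card_1_singleton_iff)
  have "w \<in> X" using w by blast
  then have "g w \<in> f ` X" using h.onto by (metis imageI)
  then obtain w' where w': "w' \<in> X" "f w' = g w" by (metis imageE)
  \<comment> \<open>As \<open>B\<close> and \<open>D\<close> carry the same colors in both rows, so does the remaining column \<open>w\<close>.\<close>
  have "w' \<notin> B \<union> D"
  proof
    assume "w' \<in> B \<union> D"
    then have "g w \<in> g ` (B \<union> D)" using w'(2) B(3) D(3) by (metis imageI image_Un)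
    then obtain m where "m \<in> B \<union> D" "g w = g m" by blast
    then show False using h.column_eqI(2)[of w m] w B D by blast
  qed
  then have "w' = w" using w w' by blast
  then show False using w' w h.column_distinct(1)[of w] by auto
qed


section \<open>Colorings of complete bipartite graphs as arrays\<close>

lemma edges_cycle_graph_6:
  "edges (cycle_graph 6) = {{0, 1}, {1, 2}, {2, 3}, {3, 4}, {4, 5}, {5, 0}}"
proof -
  have "edges (cycle_graph 6) = (\<lambda>i. {i, Suc i mod 6}) ` {..<6}"
    by (auto simp: cycle_graph_def)
  also have "{..<6::nat} = {0, 1, 2, 3, 4, 5}" by (simp add: lessThan_nat_numeral lessThan_Suc insert_commute)
  finally show ?thesis by (simp add: numeral_2_eq_2[symmetric])
qed

lemma edge_complete_bipartite_cases:
  assumes "{u, v} \<in> edges (complete_bipartite m n)"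
  obtains (row) i j where "u = Inl i" "v = Inr j" "i < m" "j < n"
  | (column) i j where "u = Inr j" "v = Inl i" "i < m" "j < n"
  using assms by (auto simp: complete_bipartite_def doubleton_eq_iff)

text \<open>The edges in the order of the cycle \<open>a1, b1, a2, b2, a3, b3\<close>. Any two of the three rows, and any
  two of the three columns, have a common neighbour on this cycle, so distinct colors entail
  that the six vertices are distinct.\<close>

definition rainbow_hexagon :: "nat \<Rightarrow> nat \<Rightarrow> ((nat + nat) set \<Rightarrow> 'c) \<Rightarrow> bool" where
  "rainbow_hexagon m n c \<longleftrightarrow> (\<exists>a1<m. \<exists>a2<m. \<exists>a3<m. \<exists>b1<n. \<exists>b2<n. \<exists>b3<n.
     distinct [c {Inl a1, Inr b1}, c {Inl a2, Inr b1}, c {Inl a2, Inr b2},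
       c {Inl a3, Inr b2}, c {Inl a3, Inr b3}, c {Inl a1, Inr b3}])"

text \<open>A closed walk of length 6 alternates between the two sides. If it starts on the side of the columns,
  the walk rotated by one step starts on the side of the rows.\<close>

lemma rainbow_hexagon_if_closed_walk:
  fixes c :: "(nat + nat) set \<Rightarrow> 'c"
  assumes d: "distinct [c {v0, v1}, c {v1, v2}, c {v2, v3}, c {v3, v4}, c {v4, v5}, c {v5, v0}]"
    and e: "{{v0, v1}, {v1, v2}, {v2, v3}, {v3, v4}, {v4, v5}, {v5, v0}}
      \<subseteq> edges (complete_bipartite m n)"
  shows "rainbow_hexagon m n c"
proof -
  have main: "rainbow_hexagon m n c"
    if v0: "v0 = Inl a1"
      and d: "distinct [c {v0, v1}, c {v1, v2}, c {v2, v3}, c {v3, v4}, c {v4, v5}, c {v5, v0}]"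
      and e: "{{v0, v1}, {v1, v2}, {v2, v3}, {v3, v4}, {v4, v5}, {v5, v0}}
        \<subseteq> edges (complete_bipartite m n)"
    for v0 v1 v2 v3 v4 v5 a1
  proof -
    have e': "{v0, v1} \<in> edges (complete_bipartite m n)" "{v1, v2} \<in> edges (complete_bipartite m n)"
      "{v2, v3} \<in> edges (complete_bipartite m n)" "{v3, v4} \<in> edges (complete_bipartite m n)"
      "{v4, v5} \<in> edges (complete_bipartite m n)"
      using e by simp_all
    obtain b1 where 1: "v1 = Inr b1" "a1 < m" "b1 < n"
      using e'(1) v0 by (auto elim: edge_complete_bipartite_cases)
    obtain a2 where 2: "v2 = Inl a2" "a2 < m"
      using e'(2) 1 by (auto elim: edge_complete_bipartite_cases)
    obtain b2 where 3: "v3 = Inr b2" "b2 < n"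
      using e'(3) 2 by (auto elim: edge_complete_bipartite_cases)
    obtain a3 where 4: "v4 = Inl a3" "a3 < m"
      using e'(4) 3 by (auto elim: edge_complete_bipartite_cases)
    obtain b3 where 5: "v5 = Inr b3" "b3 < n"
      using e'(5) 4 by (auto elim: edge_complete_bipartite_cases)
    have "distinct [c {Inl a1, Inr b1}, c {Inl a2, Inr b1}, c {Inl a2, Inr b2},
       c {Inl a3, Inr b2}, c {Inl a3, Inr b3}, c {Inl a1, Inr b3}]"
      using d unfolding v0 1 2 3 4 5 by (simp only: insert_commute)
    then show ?thesis unfolding rainbow_hexagon_def using 1 2 3 4 5 by blast
  qed
  have "{v0, v1} \<in> edges (complete_bipartite m n)" using e by simp
  then show ?thesis
  proof (cases rule: edge_complete_bipartite_cases)
    case (row i j)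
    then show ?thesis using main[of v0 i v1 v2 v3 v4 v5] d e by blast
  next
    case (column i j)
    then show ?thesis using main[of v1 i v2 v3 v4 v5 v0] d e by auto
  qed
qed

lemma forbids_multicolored_hexagons_iff:
  "forbids_multicolored (complete_bipartite m n) c (cycle_graph 6) \<longleftrightarrow> \<not> rainbow_hexagon m n c"
proof
  assume forb: "forbids_multicolored (complete_bipartite m n) c (cycle_graph 6)"
  show "\<not> rainbow_hexagon m n c"
  proof
    assume "rainbow_hexagon m n c"
    then obtain a1 a2 a3 b1 b2 b3 where ab: "a1 < m" "a2 < m" "a3 < m" "b1 < n" "b2 < n" "b3 < n"
      and d: "distinct [c {Inl a1, Inr b1}, c {Inl a2, Inr b1}, c {Inl a2, Inr b2},
       c {Inl a3, Inr b2}, c {Inl a3, Inr b3}, c {Inl a1, Inr b3}]"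
      unfolding rainbow_hexagon_def by blast
    let ?vs = "[Inl a1, Inr b1, Inl a2, Inr b2, Inl a3, Inr b3] :: (nat + nat) list"
    let ?es = "[{Inl a1, Inr b1}, {Inr b1, Inl a2}, {Inl a2, Inr b2}, {Inr b2, Inl a3},
      {Inl a3, Inr b3}, {Inr b3, Inl a1}] :: (nat + nat) set list"
    let ?H = "(set ?vs, set ?es)"
    have "distinct ?vs" using d by auto
    then have bij: "bij_betw ((!) ?vs) {..<6} (set ?vs)"
      by (intro bij_betw_nth) auto
    have "edges ?H = (\<lambda>e. (!) ?vs ` e) ` edges (cycle_graph 6)"
      unfolding edges_cycle_graph_6 by (simp add: eval_nat_numeral)
    then have "graph_iso (cycle_graph 6) ?H"
      using bij unfolding graph_iso_def by (intro exI[of _ "(!) ?vs"]) (simp add: cycle_graph_def)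
    moreover have "subgraph ?H (complete_bipartite m n)"
      using ab unfolding subgraph_def simple_graph_def complete_bipartite_def
      by (auto simp: doubleton_eq_iff)
    moreover have "multicolored c ?H"
    proof -
      have "distinct (map c ?es)" using d by (simp add: insert_commute)
      then have "inj_on c (set ?es)" by (simp only: distinct_map)
      then show ?thesis by (simp only: multicolored_def snd_conv)
    qed
    ultimately show False
      using forb unfolding forbids_multicolored_def by blast
  qed
next
  assume no: "\<not> rainbow_hexagon m n c"
  show "forbids_multicolored (complete_bipartite m n) c (cycle_graph 6)"
    unfolding forbids_multicolored_def
  proof (intro allI impI notI, elim conjE)
    fix H :: "(nat + nat) graph"
    assume sub: "subgraph H (complete_bipartite m n)" and iso: "graph_iso (cycle_graph 6) H"
      and mc: "multicolored c H"
    obtain v where bij: "bij_betw v {..<6} (verts H)"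
      and "edges H = (\<lambda>e. v ` e) ` edges (cycle_graph 6)"
      using iso unfolding graph_iso_def by (auto simp: cycle_graph_def)
    then have E: "edges H = {{v 0, v 1}, {v 1, v 2}, {v 2, v 3}, {v 3, v 4}, {v 4, v 5}, {v 5, v 0}}"
      unfolding edges_cycle_graph_6 by simp
    let ?es = "[{v 0, v 1}, {v 1, v 2}, {v 2, v 3}, {v 3, v 4}, {v 4, v 5}, {v 5, v 0}]"
    have "inj_on v {..<6}" using bij by (rule bij_betw_imp_inj_on)
    then have "distinct ?es"
      by (simp add: doubleton_eq_iff inj_on_eq_iff)
    moreover have "inj_on c (set ?es)" using mc E unfolding multicolored_def by simp
    ultimately have "distinct (map c ?es)" by (simp only: distinct_map)
    then have "distinct [c {v 0, v 1}, c {v 1, v 2}, c {v 2, v 3}, c {v 3, v 4}, c {v 4, v 5}, c {v 5, v 0}]"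
      by (simp only: list.map)
    moreover have "edges H \<subseteq> edges (complete_bipartite m n)" using sub by (simp add: subgraph_def)
    ultimately have "rainbow_hexagon m n c"
      unfolding E by (rule rainbow_hexagon_if_closed_walk)
    then show False using no by simp
  qed
qed

text \<open>An \<open>m \<times> n\<close> Latin rectangle with entries below \<open>n\<close> and without a rainbow hexagon.\<close>

definition hexagon_free_array :: "nat \<Rightarrow> nat \<Rightarrow> (nat \<Rightarrow> nat \<Rightarrow> nat) \<Rightarrow> bool" where
  "hexagon_free_array m n A \<longleftrightarrow>
    (\<forall>i<m. inj_on (A i) {..<n} \<and> A i ` {..<n} \<subseteq> {..<n}) \<and>
    (\<forall>j<n. inj_on (\<lambda>i. A i j) {..<m}) \<and>
    \<not> (\<exists>a1<m. \<exists>a2<m. \<exists>a3<m. \<exists>b1<n. \<exists>b2<n. \<exists>b3<n.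
      distinct [A a1 b1, A a2 b1, A a2 b2, A a3 b2, A a3 b3, A a1 b3])"

lemma proper_edge_coloring_complete_bipartite_iff:
  "proper_edge_coloring (complete_bipartite m n) C c \<longleftrightarrow>
    (\<forall>i<m. inj_on (\<lambda>j. c {Inl i, Inr j}) {..<n} \<and> (\<lambda>j. c {Inl i, Inr j}) ` {..<n} \<subseteq> C) \<and>
    (\<forall>j<n. inj_on (\<lambda>i. c {Inl i, Inr j}) {..<m})" (is "?L \<longleftrightarrow> ?R")
proof
  assume L: ?L
  have edge: "{Inl i, Inr j} \<in> edges (complete_bipartite m n)" if "i < m" "j < n" for i j
    using that by (auto simp: complete_bipartite_def)
  have "c {Inl i, Inr j} \<in> C" if "i < m" "j < n" for i j
    using L edge[OF that] unfolding proper_edge_coloring_def by blast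
  moreover have "c {Inl i, Inr j} \<noteq> c {Inl i', Inr j'}"
    if bounds: "i < m" "j < n" "i' < m" "j' < n" and "i = i' \<and> j \<noteq> j' \<or> j = j' \<and> i \<noteq> i'" for i j i' j'
  proof -
    have "{Inl i, Inr j} \<noteq> {Inl i', Inr j'}" "{Inl i, Inr j} \<inter> {Inl i', Inr j'} \<noteq> {}"
      using that(5) by (auto simp: doubleton_eq_iff)
    then show ?thesis
      using L edge[OF bounds(1,2)] edge[OF bounds(3,4)] by (simp add: proper_edge_coloring_def)
  qed
  ultimately show ?R unfolding inj_on_def by blast
next
  assume R: ?R
  show ?L
    unfolding proper_edge_coloring_def
  proof (intro conjI ballI impI)
    fix e assume "e \<in> edges (complete_bipartite m n)"
    then obtain i j where e: "e = {Inl i, Inr j}" "i < m" "j < n"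
      by (auto simp: complete_bipartite_def)
    then show "c e \<in> C" using R by auto
    fix e' assume "e' \<in> edges (complete_bipartite m n)" and ne: "e \<noteq> e' \<and> e \<inter> e' \<noteq> {}"
    then obtain i' j' where e': "e' = {Inl i', Inr j'}" "i' < m" "j' < n"
      by (auto simp: complete_bipartite_def)
    from ne e e' have "i = i' \<and> j \<noteq> j' \<or> j = j' \<and> i \<noteq> i'" by auto
    then show "c e \<noteq> c e'" using R e e' by (auto simp: inj_on_def)
  qed
qed

lemma FMC_6_iff:
  "(m, n) \<in> FMC 6 \<longleftrightarrow> 3 \<le> m \<and> m \<le> n \<and> 6 \<le> n \<and> (\<exists>A. hexagon_free_array m n A)"
proof -
  have coloring: "proper_edge_coloring (complete_bipartite m n) {..<n} c \<and>
      forbids_multicolored (complete_bipartite m n) c (cycle_graph 6) \<longleftrightarrow>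
      hexagon_free_array m n (\<lambda>i j. c {Inl i, Inr j})" for c
    unfolding proper_edge_coloring_complete_bipartite_iff forbids_multicolored_hexagons_iff
      hexagon_free_array_def rainbow_hexagon_def by (simp only: conj_assoc)
  have "\<exists>c. A = (\<lambda>i j. c {Inl i, Inr j})" for A :: "nat \<Rightarrow> nat \<Rightarrow> nat"
  proof
    let ?c = "\<lambda>e :: (nat + nat) set. A (THE i. Inl i \<in> e) (THE j. Inr j \<in> e)"
    show "A = (\<lambda>i j. ?c {Inl i, Inr j})" by simp
  qed
  then have "(\<exists>A. hexagon_free_array m n A) \<longleftrightarrow>
      (\<exists>c. hexagon_free_array m n (\<lambda>i j. c {Inl i, Inr j}))" by metis
  then have ex: "(\<exists>A. hexagon_free_array m n A) \<longleftrightarrow>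
      (\<exists>c. proper_edge_coloring (complete_bipartite m n) {..<n} c \<and>
        forbids_multicolored (complete_bipartite m n) c (cycle_graph 6))"
    by (simp only: coloring)
  have k: "(\<exists>k\<ge>2. 6 = 2 * k \<and> P k) \<longleftrightarrow> P 3" for P :: "nat \<Rightarrow> bool"
  proof
    assume "\<exists>k\<ge>2. 6 = 2 * k \<and> P k"
    then obtain k where "6 = 2 * k" "P k" by blast
    moreover from this(1) have "k = 3" by presburger
    ultimately show "P 3" by simp
  next
    assume "P 3"
    then show "\<exists>k\<ge>2. 6 = 2 * k \<and> P k" by (intro exI[of _ 3]) simp
  qed
  show ?thesis unfolding FMC_def mem_Collect_eq case_prod_conv k ex by simp
qed

lemma hexagon_free_rows_of_array:
  assumes A: "hexagon_free_array m n A" and i: "i1 < m" "i2 < m" "i3 < m" "distinct [i1, i2, i3]"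
  shows "hexagon_free_rows {..<n} (A i1) (A i2) (A i3)"
proof
  show "\<not> distinct [A i1 x, A i2 x, A i2 y, A i3 y, A i3 z, A i1 z]"
    if "x \<in> {..<n}" "y \<in> {..<n}" "z \<in> {..<n}" for x y z
    using A i that unfolding hexagon_free_array_def lessThan_iff by blast
  have col: "A i x \<noteq> A j x" if "i < m" "j < m" "i \<noteq> j" "x \<in> {..<n}" for i j x
    using A that unfolding hexagon_free_array_def by (auto dest!: inj_onD)
  show "A i1 x \<noteq> A i2 x" "A i2 x \<noteq> A i3 x" "A i3 x \<noteq> A i1 x" if "x \<in> {..<n}" for x
    using col[OF _ _ _ that] i by simp_all
  show "inj_on (A i1) {..<n}" "inj_on (A i2) {..<n}" "inj_on (A i3) {..<n}"
    using A i unfolding hexagon_free_array_def by simp_all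
qed

lemma array_at_most_eight_columns:
  assumes "hexagon_free_array m n A" "3 \<le> m"
  shows "n \<le> 8"
  using hexagon_free_rows.at_most_eight_columns[OF hexagon_free_rows_of_array[OF assms(1), of 0 1 2]]
    assms(2) by simp

text \<open>With as many colors as columns every row is onto, so that the results on three rows of length seven
  apply to the rows 0, 1, 2 and to the rows 0, 1, 3.\<close>

lemma array_seven_columns_at_most_three_rows:
  assumes A: "hexagon_free_array m 7 A"
  shows "m \<le> 3"
proof (rule ccontr)
  assume m: "\<not> m \<le> 3"
  have onto: "A i ` {..<7} = {..<7}" if "i < m" for i
    using A that unfolding hexagon_free_array_def
    by (intro card_subset_eq) (auto simp: card_image)
  have rows: "hexagon_free_rows_7 {..<7} (A 0) (A 1) (A i) {..<7}" if "i = 2 \<or> i = 3" for i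
  proof -
    have i: "0 < m" "1 < m" "i < m" "distinct [0, 1, i]" using m that by auto
    show ?thesis
      using hexagon_free_rows_of_array[OF A i] onto[OF i(1)] onto[OF i(2)] onto[OF i(3)]
      by (simp add: hexagon_free_rows_7_def hexagon_free_rows_7_axioms_def)
  qed
  have "A 2 x \<noteq> A 3 x" if "x \<in> {..<7}" for x
    using hexagon_free_rows.column_distinct(1)[OF hexagon_free_rows_of_array[OF A, of 2 3 0]] that m
    by simp
  then show False using no_four_rows_of_length_7 rows[of 2] rows[of 3] by blast
qed


section \<open>Constructions\<close>

lemma hexagon_free_array_take_rows:
  assumes "hexagon_free_array m n A" "m' \<le> m"
  shows "hexagon_free_array m' n A"
  unfolding hexagon_free_array_def
proof (intro conjI)
  have le: "i < m" if "i < m'" for i using that assms(2) by simp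
  show "\<forall>i<m'. inj_on (A i) {..<n} \<and> A i ` {..<n} \<subseteq> {..<n}"
    using assms le by (simp add: hexagon_free_array_def)
  show "\<forall>j<n. inj_on (\<lambda>i. A i j) {..<m'}"
  proof (intro allI impI)
    fix j assume "j < n"
    then have "inj_on (\<lambda>i. A i j) {..<m}" using assms(1) by (simp add: hexagon_free_array_def)
    then show "inj_on (\<lambda>i. A i j) {..<m'}" by (rule inj_on_subset) (use assms(2) in auto)
  qed
  show "\<not> (\<exists>a1<m'. \<exists>a2<m'. \<exists>a3<m'. \<exists>b1<n. \<exists>b2<n. \<exists>b3<n.
      distinct [A a1 b1, A a2 b1, A a2 b2, A a3 b2, A a3 b3, A a1 b3])" (is "\<not> ?small")
  proof
    assume ?small
    then have "\<exists>a1<m. \<exists>a2<m. \<exists>a3<m. \<exists>b1<n. \<exists>b2<n. \<exists>b3<n.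
      distinct [A a1 b1, A a2 b1, A a2 b2, A a3 b2, A a3 b3, A a1 b3]" using le by blast
    then show False using assms(1) unfolding hexagon_free_array_def by (elim conjE notE)
  qed
qed

text \<open>The six entries of a rainbow hexagon would be all the residues modulo 6, with sum 15. Their sum is
  even, since 6 is even and every row and every column index occurs in two of them.\<close>

lemma hexagon_free_array_cyclic_group_6: "hexagon_free_array 6 6 (\<lambda>i j. (i + j) mod 6)"
  unfolding hexagon_free_array_def
proof (intro conjI allI impI notI)
  have cancel: "x = y" if "(i + x) mod 6 = (i + y) mod 6" "x < 6" "y < 6" for i x y :: nat
  proof -
    have "(5 * i + (i + x)) mod 6 = (5 * i + (i + y)) mod 6"
      using mod_add_cong[OF refl that(1)] .
    then have "(6 * i + x) mod 6 = (6 * i + y) mod 6" by (simp add: algebra_simps)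
    then show ?thesis using that(2,3) by simp
  qed
  show "inj_on (\<lambda>j. (i + j) mod 6) {..<6}" for i :: nat
    using cancel by (auto intro!: inj_onI)
  show "inj_on (\<lambda>i. (i + j) mod 6) {..<6}" for j :: nat
    using cancel[of j] by (auto intro!: inj_onI simp: add.commute[of _ j])
  assume "\<exists>a1<6. \<exists>a2<6. \<exists>a3<6. \<exists>b1<6. \<exists>b2<6. \<exists>b3<6. distinct [(a1 + b1) mod 6, (a2 + b1) mod 6,
    (a2 + b2) mod 6, (a3 + b2) mod 6, (a3 + b3) mod 6, (a1 + b3) mod (6::nat)]"
  then obtain a1 a2 a3 b1 b2 b3 :: nat where d: "distinct [(a1 + b1) mod 6, (a2 + b1) mod 6,
    (a2 + b2) mod 6, (a3 + b2) mod 6, (a3 + b3) mod 6, (a1 + b3) mod 6]" (is "distinct ?vs")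
    by blast
  have "set ?vs = {..<6}"
    using distinct_card[OF d] by (intro card_subset_eq) auto
  then have "sum_list ?vs = \<Sum>{..<6::nat}"
    using d by (simp only: distinct_sum_list_conv_Sum)
  also have "\<dots> = 15" by (simp add: lessThan_nat_numeral lessThan_Suc)
  finally have "odd (sum_list ?vs)" by simp
  moreover have par: "even (v mod 6) \<longleftrightarrow> even v" for v :: nat by presburger
  have "even (sum_list ?vs)" by (simp add: par, argo)
  ultimately show False by blast
qed auto

lemma xor_left_cancel: "(xor a b = xor a c) \<longleftrightarrow> b = (c :: nat)"
  by (metis xor.assoc xor_self_eq xor.left_neutral)

text \<open>The numbers below 8 under bitwise exclusive or form the elementary abelian group of order 8. The
  entries of a hexagon sum to 0 in it, as every row and column index occurs twice; so do all eight
  elements. Six distinct entries would therefore leave two distinct elements with sum 0. In terms of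
  bits: each of the three bits is set in four of the eight numbers and in an even number of the
  entries, hence in both or none of the two missing numbers \<open>p\<close> and \<open>q\<close>.\<close>

lemma hexagon_free_array_elementary_abelian_8: "hexagon_free_array 8 8 xor"
  unfolding hexagon_free_array_def
proof (intro conjI allI impI notI)
  have xor_less: "xor i j < 8" if "i < 8" "j < 8" for i j :: nat
  proof -
    have "xor i j = take_bit 3 (xor i j)" using that by (simp add: take_bit_xor take_bit_nat_eq_self)
    also have "\<dots> < 2 ^ 3" by (rule take_bit_nat_less_exp)
    finally show ?thesis by simp
  qed
  then show "xor i ` {..<8} \<subseteq> {..<8}" if "i < 8" for i :: nat using that by auto
  show "inj_on (xor i) {..<8}" "inj_on (\<lambda>i. xor i j) {..<8}" for i j :: nat
    by (auto simp: inj_on_def xor_left_cancel xor.commute[of _ j])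
  assume "\<exists>a1<8. \<exists>a2<8. \<exists>a3<8. \<exists>b1<8. \<exists>b2<8. \<exists>b3<8.
    distinct [xor a1 b1, xor a2 b1, xor a2 b2, xor a3 b2, xor a3 b3, xor a1 (b3::nat)]"
  then obtain a1 a2 a3 b1 b2 b3 :: nat
    where less: "a1 < 8" "a2 < 8" "a3 < 8" "b1 < 8" "b2 < 8" "b3 < 8"
    and d: "distinct [xor a1 b1, xor a2 b1, xor a2 b2, xor a3 b2, xor a3 b3, xor a1 b3]"
      (is "distinct ?vs") by blast
  have sub: "set ?vs \<subseteq> {..<8}" using less xor_less by simp
  have "card ({..<8} - set ?vs) = 2"
    using distinct_card[OF d] sub by (subst card_Diff_subset) auto
  then obtain p q where pq: "{..<8} - set ?vs = {p, q}" "p \<noteq> q" by (auto simp: card_2_iff)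
  have "bit p k = bit q k" if k: "k < 3" for k
  proof -
    let ?t = "\<lambda>v::nat. of_bool (bit v k) :: nat"
    have "{..<8::nat} = {0, 1, 2, 3, 4, 5, 6, 7}"
      by (simp add: lessThan_nat_numeral lessThan_Suc insert_commute)
    moreover have "k = 0 \<or> k = 1 \<or> k = 2" using k by auto
    ultimately have "(\<Sum>v<8. ?t v) = 4"
      by (elim disjE) (simp_all del: sum_of_bool_eq add: bit_iff_odd)
    moreover have "(\<Sum>v<8. ?t v) = sum ?t {p, q} + sum ?t (set ?vs)"
      unfolding pq(1)[symmetric] by (rule sum.subset_diff[OF sub]) simp
    moreover have "sum ?t {p, q} = ?t p + ?t q" using pq(2) by (simp del: sum_of_bool_eq)
    moreover have "sum ?t (set ?vs) = sum_list (map ?t ?vs)"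
      using d by (rule sum.distinct_set_conv_list)
    ultimately have "?t p + ?t q + sum_list (map ?t ?vs) = 4" by (simp only:)
    moreover have "even (sum_list (map ?t ?vs))"
      by (simp add: bit_xor_iff)
    ultimately have "even (?t p + ?t q)" by (metis even_add even_numeral)
    then show ?thesis by (cases "bit p k"; cases "bit q k") simp_all
  qed
  moreover have "p < 8" "q < 8" using pq by blast+
  ultimately have "take_bit 3 p = take_bit 3 q" by (auto simp: bit_eq_iff bit_take_bit_iff)
  then have "p = q" using \<open>p < 8\<close> \<open>q < 8\<close> by (simp add: take_bit_nat_eq_self)
  then show False using pq(2) by simp
qed

text \<open>The first four columns are rows of the addition table of the Klein four-group on the colors 0 to 3, the
  last three a cyclic Latin square on the colors 4 to 6.\<close>

definition rectangle_3_7 :: "nat list list" where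
  "rectangle_3_7 = [[0, 1, 2, 3, 4, 5, 6], [1, 0, 3, 2, 5, 6, 4], [2, 3, 0, 1, 6, 4, 5]]"

text \<open>There is a reason for what the evaluation confirms. Two columns of a hexagon contribute four entries and three contribute
  six, so a rainbow hexagon cannot take two columns from the block with three colors, nor all three from the
  one with four. Otherwise it takes two columns of the Klein block, whose four entries would be all of
  the Klein group, with sum 0. But these two columns omit different rows, and the four entries sum to
  the sum of the indices of these two rows, which is not 0.\<close>

lemma hexagon_free_array_3_7: "hexagon_free_array 3 7 (\<lambda>i j. rectangle_3_7 ! i ! j)"
proof -
  let ?A = "\<lambda>i j. rectangle_3_7 ! i ! j"
  have no_hexagon: "\<forall>a1\<in>set [0,1,2]. \<forall>a2\<in>set [0,1,2]. \<forall>a3\<in>set [0,1,2].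
    distinct [a1, a2, a3] \<longrightarrow> (\<forall>b1\<in>set [0..<7]. \<forall>b2\<in>set [0..<7]. \<forall>b3\<in>set [0..<7].
      \<not> distinct [rectangle_3_7 ! a1 ! b1, rectangle_3_7 ! a2 ! b1, rectangle_3_7 ! a2 ! b2,
        rectangle_3_7 ! a3 ! b2, rectangle_3_7 ! a3 ! b3, rectangle_3_7 ! a1 ! b3])"
    by code_simp
  have three: "set [0, 1, 2] = {..<3::nat}" and seven: "set [0..<7] = {..<7::nat}"
    by (auto simp: lessThan_nat_numeral lessThan_Suc)
  have "\<forall>i\<in>set [0, 1, 2]. distinct (map (?A i) [0..<7]) \<and> (\<forall>j\<in>set [0..<7]. ?A i j < 7)"
    and "\<forall>j\<in>set [0..<7]. distinct (map (\<lambda>i. ?A i j) [0, 1, 2])"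
    by code_simp+
  then have latin: "\<forall>i<3. inj_on (?A i) {..<7} \<and> (\<forall>j<7. ?A i j < 7)"
      "\<forall>j<7. inj_on (\<lambda>i. ?A i j) {..<3}"
    unfolding distinct_map three seven by (simp_all only: Ball_def lessThan_iff) blast+
  show ?thesis
    unfolding hexagon_free_array_def
  proof (intro conjI notI)
    show "\<forall>i<3. inj_on (?A i) {..<7} \<and> ?A i ` {..<7} \<subseteq> {..<7}" using latin(1) by auto
    show "\<forall>j<7. inj_on (\<lambda>i. ?A i j) {..<3}" by (rule latin(2))
    assume "\<exists>a1<3. \<exists>a2<3. \<exists>a3<3. \<exists>b1<7. \<exists>b2<7. \<exists>b3<7.
      distinct [?A a1 b1, ?A a2 b1, ?A a2 b2, ?A a3 b2, ?A a3 b3, ?A a1 b3]"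
    then obtain a1 a2 a3 b1 b2 b3 where less: "a1 < 3" "a2 < 3" "a3 < 3" "b1 < 7" "b2 < 7" "b3 < 7"
      and d: "distinct [?A a1 b1, ?A a2 b1, ?A a2 b2, ?A a3 b2, ?A a3 b3, ?A a1 b3]"
      by blast
    have "distinct [a1, a2, a3]" using d by auto
    then show False using no_hexagon less d unfolding three seven by (simp only: Ball_def lessThan_iff)
  qed
qed

theorem theorem9:
  "FMC 6 = {(m, 6) |m. 3 \<le> m \<and> m \<le> 6} \<union> {(3, 7)} \<union> {(m, 8) |m. 3 \<le> m \<and> m \<le> 8}"
    (is "_ = ?R")
proof (rule set_eqI)
  fix mn :: "nat \<times> nat"
  obtain m n where mn: "mn = (m, n)" by force
  have "(m, n) \<in> FMC 6 \<longleftrightarrow> (m, n) \<in> ?R"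
  proof
    assume "(m, n) \<in> FMC 6"
    then obtain A where A: "hexagon_free_array m n A" and mn: "3 \<le> m" "m \<le> n" "6 \<le> n"
      unfolding FMC_6_iff by blast
    have "n \<le> 8" using array_at_most_eight_columns[OF A mn(1)] .
    then consider "n = 6" | "n = 7" | "n = 8" using mn(3) by linarith
    then show "(m, n) \<in> ?R"
    proof cases
      case 2
      then have "m \<le> 3" using array_seven_columns_at_most_three_rows A by blast
      then show ?thesis using 2 mn by simp
    qed (use mn in simp_all)
  next
    assume "(m, n) \<in> ?R"
    then consider "3 \<le> m" "m \<le> 6" "n = 6" | "m = 3" "n = 7" | "3 \<le> m" "m \<le> 8" "n = 8" by auto
    then show "(m, n) \<in> FMC 6"
    proof cases
      case 1
      then show ?thesis unfolding FMC_6_iff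
        using hexagon_free_array_take_rows[OF hexagon_free_array_cyclic_group_6] by auto
    next
      case 2
      then show ?thesis unfolding FMC_6_iff using hexagon_free_array_3_7 by auto
    next
      case 3
      then show ?thesis unfolding FMC_6_iff
        using hexagon_free_array_take_rows[OF hexagon_free_array_elementary_abelian_8] by auto
    qed
  qed
  then show "mn \<in> FMC 6 \<longleftrightarrow> mn \<in> ?R" by (simp only: mn)
qed

end
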